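(* Let $\ell_1,\dots,\ell_4\subset\mathbb{P}^3$ be four pairwise skew lines. Then there is a quartic determinantal surface $S\subset\mathbb{P}^3$ containing $\ell_1,\dots,\ell_4$ that is the critical locus for two $4$-tuples of projections $P_i,Q_i:\mathbb{P}^3\dashrightarrow\mathbb{P}^1$, $i=1,\dots,4$, where the lines $\ell_1,\dots,\ell_4$ are the centers of $Q_1,\dots,Q_4$ respectively.
   Context: We work over $\mathbb{C}$. A projection $P:\mathbb{P}^3\dashrightarrow\mathbb{P}^1$ is given by a $2\times 4$ complex matrix of rank $2$ (up to a nonzero scalar), also denoted $P$; its center is the line in $\mathbb{P}^3$ given by the kernel of the matrix. With $\mathbf{X}=(x_0,\dots,x_3)^T$, $Q_i(\mathbf{X})=Q_i\cdot\mathbf{X}$ is a column of $2$ linear forms. The critical locus of the two $4$-tuples is the subscheme of $\mathbb{P}^3$ defined by the vanishing of the determinant of the square matrix of order $8$ $$M=\begin{pmatrix} P_1 & Q_1(\mathbf{X}) & 0 & 0 & 0\\ P_2 & 0 & Q_2(\mathbf{X}) & 0 & 0\\ P_3 & 0 & 0 & Q_3(\mathbf{X}) & 0\\ P_4 & 0 & 0 & 0 & Q_4(\mathbf{X})\end{pmatrix}.$$ It is always required that the centers of $P_1,\dots,P_4$ have empty common intersection and likewise for $Q_1,\dots,Q_4$. A quartic determinantal surface is a surface in $\mathbb{P}^3$ defined by the (nonzero) determinant of a $4\times 4$ matrix of linear forms. *)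

theory Defs
  imports
    Complex_Main
    "HOL-Library.Numeral_Type"
    "HOL-Library.Poly_Mapping"
    "Jordan_Normal_Form.Determinant"
    "Jordan_Normal_Form.Matrix_Kernel"
    "Jordan_Normal_Form.DL_Rank"
begin

text \<open>The homogeneous coordinate ring of \<open>\<P>\<^sup>3\<close> over the complex numbers. The four variables
  \<open>x\<^sub>0, \<dots>, x\<^sub>3\<close> are indexed by the type \<open>4\<close>, whose elements are \<open>of_nat j\<close> for \<open>j < 4\<close>.\<close>

type_synonym cpoly4 = "(4 \<Rightarrow>\<^sub>0 nat) \<Rightarrow>\<^sub>0 complex"

definition Const :: "complex \<Rightarrow> cpoly4" where
  "Const c = Poly_Mapping.single 0 c"

definition Var :: "nat \<Rightarrow> cpoly4" where
  "Var j = Poly_Mapping.single (Poly_Mapping.single (of_nat j) 1) 1"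

definition lin_form :: "complex vec \<Rightarrow> cpoly4" where
  "lin_form c = (\<Sum>j<4. Const (c $ j) * Var j)"

definition eval_poly4 :: "cpoly4 \<Rightarrow> complex vec \<Rightarrow> complex" where
  "eval_poly4 F x =
     (\<Sum>m \<in> Poly_Mapping.keys F.
        Poly_Mapping.lookup F m * (\<Prod>j<4. (x $ j) ^ Poly_Mapping.lookup m (of_nat j)))"

text \<open>Linear subvarieties of \<open>\<P>\<^sup>3\<close> are represented by the corresponding linear subspaces of
  \<open>carrier_vec 4\<close>, so the empty subvariety is \<open>{0\<^sub>v 4}\<close>.\<close>

definition proj_line :: "complex vec set \<Rightarrow> bool" where
  "proj_line L \<longleftrightarrow>
     VectorSpace.subspace class_ring L (module_vec TYPE(complex) 4) \<and>
     vectorspace.dim class_ring ((module_vec TYPE(complex) 4)\<lparr>carrier := L\<rparr>) = 2"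

definition skew :: "complex vec set \<Rightarrow> complex vec set \<Rightarrow> bool" where
  "skew L L' \<longleftrightarrow> L \<inter> L' = {0\<^sub>v 4}"

text \<open>Hypersurfaces are closed subschemes of \<open>\<P>\<^sup>3\<close> and are represented by their homogeneous ideals.
  The ideal \<open>(F)\<close> generated by a form \<open>F\<close> is saturated, so two forms define the same subscheme
  iff they generate the same ideal.\<close>

definition hypersurface :: "cpoly4 \<Rightarrow> cpoly4 set" where
  "hypersurface F = {G * F | G. True}"

definition vanishing_ideal :: "complex vec set \<Rightarrow> cpoly4 set" where
  "vanishing_ideal A = {G. \<forall>x\<in>A. eval_poly4 G x = 0}"

definition contains_line :: "cpoly4 set \<Rightarrow> complex vec set \<Rightarrow> bool" where
  "contains_line S L \<longleftrightarrow> S \<subseteq> vanishing_ideal L"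

definition quartic_determinantal_surface :: "cpoly4 set \<Rightarrow> bool" where
  "quartic_determinantal_surface S \<longleftrightarrow>
     (\<exists>N \<in> carrier_mat 4 4.
        (\<forall>r<4. \<forall>c<4. N $$ (r, c) \<in> lin_form ` carrier_vec 4) \<and>
        det N \<noteq> 0 \<and> S = hypersurface (det N))"

definition projection_mat :: "complex mat \<Rightarrow> bool" where
  "projection_mat A \<longleftrightarrow> A \<in> carrier_mat 2 4 \<and> vec_space.rank 2 A = 2"

definition center :: "complex mat \<Rightarrow> complex vec set" where
  "center A = mat_kernel A"

text \<open>A 4-tuple of projections is a function on \<open>{..<4}\<close>: the \<open>i\<close>-th entry here is the
  \<open>(i+1)\<close>-st projection in 1-based numbering.\<close>

definition projection_4tuple :: "(nat \<Rightarrow> complex mat) \<Rightarrow> bool" where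
  "projection_4tuple P \<longleftrightarrow>
     (\<forall>i<4. projection_mat (P i)) \<and> (\<Inter>i<4. center (P i)) = {0\<^sub>v 4}"

text \<open>Row \<open>r\<close> of \<open>M\<close> is row \<open>r mod 2\<close> of the block row \<open>r div 2\<close>; columns \<open>0\<close> to \<open>3\<close> are the
  scalar part, and column \<open>4 + i\<close> carries the two linear forms \<open>Q\<^sub>i(X)\<close> in block row \<open>i\<close>.\<close>

definition critical_mat :: "(nat \<Rightarrow> complex mat) \<Rightarrow> (nat \<Rightarrow> complex mat) \<Rightarrow> cpoly4 mat" where
  "critical_mat P Q = mat 8 8 (\<lambda>(r, c).
     if c < 4 then Const (P (r div 2) $$ (r mod 2, c))
     else if c = 4 + r div 2 then lin_form (row (Q (r div 2)) (r mod 2))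
     else 0)"

definition critical_locus :: "(nat \<Rightarrow> complex mat) \<Rightarrow> (nat \<Rightarrow> complex mat) \<Rightarrow> cpoly4 set" where
  "critical_locus P Q = hypersurface (det (critical_mat P Q))"

end

theory Submission
  imports Defs
begin

text \<open>Take \<open>P\<^sub>1 = P\<^sub>3\<close> and \<open>P\<^sub>2 = P\<^sub>4\<close> to be the projections onto the first and the last
  two coordinates. The scalar part of \<open>M\<close> is then a stack of two identity matrices, so \<open>det M\<close> is a
  \<open>4 \<times> 4\<close> determinant of linear forms, equal to \<open>-(Q\<^sub>1 \<and> Q\<^sub>3)(Q\<^sub>2 \<and> Q\<^sub>4)\<close>, where
  \<open>a \<and> b = a\<^sub>0 b\<^sub>1 - a\<^sub>1 b\<^sub>0\<close>: the union of a quadric through the lines 1 and 3 and a quadric through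
  the lines 2 and 4. Two skew lines span the whole space, hence the stacked matrix of \<open>Q\<^sub>1\<close> and
  \<open>Q\<^sub>3\<close> is invertible, and \<open>Q\<^sub>1 \<and> Q\<^sub>3\<close> is nonzero at a point mapped to the two unit vectors.\<close>


section \<open>Linear algebra: bases of subspaces and full rank\<close>

text \<open>Independent subsets of \<open>L\<close> are independent in the ambient space, so they
  have at most \<open>n\<close> elements and a maximal one exists. Span and independence inside
  \<open>L\<close> agree with the ambient notions, so this maximal set is a basis of
  \<open>L\<close>.\<close>

lemma (in vec_space) subspace_finite_basis:
  assumes L: "VectorSpace.subspace class_ring L V"
  shows "\<exists>B. finite B \<and> B \<subseteq> L \<and> lin_indpt B \<and> span B = L
           \<and> card B = vectorspace.dim class_ring (V\<lparr>carrier := L\<rparr>)"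
proof -
  have sub: "submodule class_ring L V" using L by simp
  have vsL: "vectorspace class_ring (vs L)" using L by (rule subspace_is_vs)
  interpret W: vectorspace class_ring "vs L" by (rule vsL)
  have LC: "L \<subseteq> carrier_vec n" using sub unfolding submodule_def by auto
  have bounded: "finite S \<and> card S \<le> n" if "S \<subseteq> L \<and> lin_indpt S" for S
  proof -
    have "S \<subseteq> carrier_vec n" using that LC by (meson subset_trans)
    with that show ?thesis using li_le_dim[OF fin_dim, of S] dim_is_n by simp
  qed
  have "lin_indpt {}" unfolding lin_dep_def by blast
  then obtain B where B: "finite B" "maximal B (\<lambda>S. S \<subseteq> L \<and> lin_indpt S)"
    using maximal_exists[of "\<lambda>S. S \<subseteq> L \<and> lin_indpt S" n "{}"] bounded by blast
  have "(\<lambda>S. S \<subseteq> L \<and> lin_indpt S) = (\<lambda>S. S \<subseteq> carrier (vs L) \<and> W.lin_indpt S)"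
    using span_li_not_depend(2)[OF _ sub] by auto
  with B have "W.basis B" by (intro W.max_li_is_basis) simp
  then have "W.span B = L" "B \<subseteq> L" "card B = W.dim"
    unfolding W.basis_def using W.dim_basis[OF B(1)] \<open>W.basis B\<close> by auto
  then show ?thesis using B span_li_not_depend(1)[OF _ sub, of B] 
    unfolding maximal_def by auto
qed

text \<open>Turns the abstract dimension in \<open>proj_line\<close> into a matrix: the columns of
  \<open>U\<close> form a basis of \<open>L\<close>. Spanning gives the image, independence the
  trivial kernel.\<close>

lemma subspace_parametrization:
  fixes L :: "'a :: field vec set"
  assumes L: "VectorSpace.subspace class_ring L (module_vec TYPE('a) n)"
    and d: "vectorspace.dim class_ring ((module_vec TYPE('a) n)\<lparr>carrier := L\<rparr>) = d"
  shows "\<exists>U \<in> carrier_mat n d. L = (\<lambda>y. U *\<^sub>v y) ` carrier_vec d \<and> mat_kernel U = {0\<^sub>v d}"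
proof -
  interpret vec_space "TYPE('a)" n .
  obtain B where B: "finite B" "B \<subseteq> L" "lin_indpt B" "span B = L" "card B = d"
    using subspace_finite_basis[OF L] d by auto
  obtain ws where ws: "set ws = B" "distinct ws" using finite_distinct_list[OF B(1)] by blast
  have BC: "B \<subseteq> carrier_vec n" using B L unfolding subspace_def submodule_def by auto
  have len: "length ws = d" using ws B(5) distinct_card by fastforce
  define U where "U = mat_of_cols n ws"
  have U: "U \<in> carrier_mat n d" unfolding U_def using len by auto
  have cU: "cols U = ws" unfolding U_def using BC ws by (simp add: cols_mat_of_cols)
  have dist: "distinct (cols U)" and setc: "set (cols U) = B" using cU ws by auto
  have "L = (\<lambda>y. U *\<^sub>v y) ` carrier_vec d"
  proof
    show "L \<subseteq> (\<lambda>y. U *\<^sub>v y) ` carrier_vec d"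
    proof
      fix x assume "x \<in> L"
      then obtain a where a: "lincomb a B = x" using B BC finite_in_span[of B x] by auto
      have "U *\<^sub>v vec d (\<lambda>i. a (col U i)) = x"
        using mat_mult_eq_lincomb[OF U dist, of a] setc a by simp
      then show "x \<in> (\<lambda>y. U *\<^sub>v y) ` carrier_vec d" by force
    qed
    show "(\<lambda>y. U *\<^sub>v y) ` carrier_vec d \<subseteq> L"
    proof
      fix x assume "x \<in> (\<lambda>y. U *\<^sub>v y) ` carrier_vec d"
      then obtain y where "y \<in> carrier_vec d" "x = U *\<^sub>v y" by blast
      \<comment> \<open>Since the columns are distinct, \<open>find_first\<close> recovers the index
        of a column, and with it the coefficient that \<open>y\<close> gives to that basis
        vector.\<close>
      then have "x = lincomb (\<lambda>a. y $ find_first a (cols U)) B"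
        using lincomb_eq_mat_mult[OF U _ dist] setc by simp
      then show "x \<in> L" using in_spanI[OF _ B(1) subset_refl] B(4) by simp
    qed
  qed
  moreover have "mat_kernel U = {0\<^sub>v d}"
  proof -
    have "y = 0\<^sub>v d" if "y \<in> carrier_vec d" "U *\<^sub>v y = 0\<^sub>v n" for y
      using lin_depI[OF U that(1) _ that(2) dist] B(3) setc by blast
    then show ?thesis unfolding mat_kernel[OF U] using U by auto
  qed
  ultimately show ?thesis using U by blast
qed

text \<open>Every vector hit by \<open>A\<close> is a combination of its columns, so surjectivity
  makes the column space all of \<open>carrier_vec n\<close>. This is how the rank condition in
  \<open>projection_mat\<close> is verified.\<close>

lemma rank_surjective:
  fixes A :: "'a :: field mat"
  assumes A: "A \<in> carrier_mat n m"
    and surj: "\<And>y. y \<in> carrier_vec n \<Longrightarrow> \<exists>x \<in> carrier_vec m. A *\<^sub>v x = y"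
  shows "vec_space.rank n A = n"
proof -
  interpret vec_space "TYPE('a)" n .
  have C: "set (cols A) \<subseteq> carrier_vec n" using A cols_dim by blast
  have "span (set (cols A)) = carrier_vec n"
  proof
    show "span (set (cols A)) \<subseteq> carrier_vec n" using C span_is_subset2 by auto
    show "carrier_vec n \<subseteq> span (set (cols A))"
    proof
      fix y :: "'a vec" assume "y \<in> carrier_vec n"
      then obtain x where x: "x \<in> carrier_vec m" "A *\<^sub>v x = y" using surj by blast
      have "vec m (\<lambda>i. x $ i) = x" using x(1) by auto
      then have "mat_of_cols n (cols A) *\<^sub>v vec m (\<lambda>i. x $ i) = y"
        using x A mat_of_cols_cols[of A] by auto
      then have "lincomb_list (\<lambda>i. x $ i) (cols A) = y"
        using lincomb_list_as_mat_mult[of "cols A" "\<lambda>i. x $ i"] C A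
        by (metis carrier_matD(2) carrier_vecD cols_length subsetD)
      then show "y \<in> span (set (cols A))"
        unfolding span_list_as_span[OF C, symmetric] using in_span_listI by blast
    qed
  qed
  then show ?thesis unfolding rank_def using dim_is_n by (simp add: module_vec_def)
qed

section \<open>Evaluation of polynomials at a point\<close>

definition monom_value :: "complex vec \<Rightarrow> (4 \<Rightarrow>\<^sub>0 nat) \<Rightarrow> complex" where
  "monom_value x m = (\<Prod>j<4. (x $ j) ^ Poly_Mapping.lookup m (of_nat j))"

lemma monom_value_0 [simp]: "monom_value x 0 = 1"
  by (simp add: monom_value_def)

lemma monom_value_add: "monom_value x (m + m') = monom_value x m * monom_value x m'"
  by (simp add: monom_value_def lookup_add power_add prod.distrib)

text \<open>Cancellation can make the keys of \<open>F + G\<close> smaller than the union of the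
  keys. Summing over a common finite superset puts all three evaluations over one index set.\<close>

lemma eval_poly4_superset:
  assumes "finite S" "Poly_Mapping.keys F \<subseteq> S"
  shows "eval_poly4 F x = (\<Sum>m\<in>S. Poly_Mapping.lookup F m * monom_value x m)"
  unfolding eval_poly4_def monom_value_def using assms
  by (intro sum.mono_neutral_left) (auto simp: in_keys_iff)

lemma eval_poly4_add: "eval_poly4 (F + G) x = eval_poly4 F x + eval_poly4 G x"
proof -
  let ?S = "Poly_Mapping.keys F \<union> Poly_Mapping.keys G"
  have S: "finite ?S" "Poly_Mapping.keys (F + G) \<subseteq> ?S" by (simp_all add: keys_add)
  show ?thesis
    using eval_poly4_superset[OF S] eval_poly4_superset[of ?S F] eval_poly4_superset[of ?S G]
    by (simp add: lookup_add sum.distrib ring_distribs)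
qed

lemma eval_poly4_single: "eval_poly4 (Poly_Mapping.single m c) x = c * monom_value x m"
  using eval_poly4_superset[of "{m}" "Poly_Mapping.single m c"] by simp

lemma eval_poly4_sum: "eval_poly4 (\<Sum>i\<in>A. F i) x = (\<Sum>i\<in>A. eval_poly4 (F i) x)"
proof (induction A rule: infinite_finite_induct)
  case (infinite A)
  then show ?case by (simp add: eval_poly4_def)
next
  case empty
  then show ?case by (simp add: eval_poly4_def)
next
  case (insert a A)
  then show ?case by (simp add: eval_poly4_add)
qed

lemma poly_mapping_eq_sum_single:
  "F = (\<Sum>m\<in>Poly_Mapping.keys F. Poly_Mapping.single m (Poly_Mapping.lookup F m))"
  by (intro poly_mapping_eqI) (auto simp: lookup_sum lookup_single when_def in_keys_iff)

lemma eval_poly4_mult: "eval_poly4 (F * G) x = eval_poly4 F x * eval_poly4 G x"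
proof -
  have "F * G = (\<Sum>m\<in>Poly_Mapping.keys F. \<Sum>k\<in>Poly_Mapping.keys G.
      Poly_Mapping.single (m + k) (Poly_Mapping.lookup F m * Poly_Mapping.lookup G k))"
    by (subst (1) poly_mapping_eq_sum_single[of F], subst (1) poly_mapping_eq_sum_single[of G])
      (simp add: sum_product mult_single)
  then have "eval_poly4 (F * G) x = (\<Sum>m\<in>Poly_Mapping.keys F. \<Sum>k\<in>Poly_Mapping.keys G.
      (Poly_Mapping.lookup F m * monom_value x m) * (Poly_Mapping.lookup G k * monom_value x k))"
    by (simp add: eval_poly4_sum eval_poly4_single monom_value_add mult_ac)
  then show ?thesis
    unfolding eval_poly4_def monom_value_def sum_product .
qed

text \<open>As a ring homomorphism, evaluation can be pushed through the products and differences in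
  the determinant with \<open>hom_distribs\<close>.\<close>

interpretation eval_poly4_hom: comm_ring_hom "\<lambda>F. eval_poly4 F x" for x
proof unfold_locales
  show "eval_poly4 1 x = 1"
    using eval_poly4_single[of 0 1 x] by (simp add: single_one)
qed (simp_all add: eval_poly4_add eval_poly4_mult, simp add: eval_poly4_def)

lemma eval_poly4_Const [simp]: "eval_poly4 (Const c) x = c"
  by (simp add: Const_def eval_poly4_single)

lemma eval_poly4_Var:
  assumes "j < 4"
  shows "eval_poly4 (Var j) x = x $ j"
proof -
  \<comment> \<open>The cast into the type \<open>4\<close> is reduction modulo 4, injective on
    indices below 4, so only the factor at \<open>j\<close> survives in the product.\<close>
  have "(of_nat i :: 4) = of_nat j \<longleftrightarrow> i = j" if "i < 4" for i
    using that assms by (auto simp: numeral_eq_Suc less_Suc_eq)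
  then have "monom_value x (Poly_Mapping.single (of_nat j) 1) = (\<Prod>i<4. if i = j then x $ i else 1)"
    unfolding monom_value_def by (intro prod.cong refl) (simp add: lookup_single when_def eq_commute)
  then show ?thesis using assms by (simp add: Var_def eval_poly4_single)
qed

lemma eval_poly4_lin_form:
  assumes "x \<in> carrier_vec 4"
  shows "eval_poly4 (lin_form c) x = c \<bullet> x"
  using assms unfolding lin_form_def
  by (auto simp: eval_poly4_sum eval_poly4_mult eval_poly4_Var scalar_prod_def atLeast0LessThan)

text \<open>Block elimination negates two columns of the final matrix; their entries must still be
  recognized as linear forms.\<close>

lemma lin_form_uminus: "c \<in> carrier_vec 4 \<Longrightarrow> lin_form (- c) = - lin_form c"
  by (simp add: lin_form_def Const_def single_uminus sum_negf)

lemma lin_form_0 [simp]: "lin_form (0\<^sub>v 4) = 0"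
  by (simp add: lin_form_def Const_def)

section \<open>Determinants of small matrices and of \<open>critical_mat\<close>\<close>

lemma det_carrier_2:
  fixes A :: "'a :: comm_ring_1 mat"
  assumes A: "A \<in> carrier_mat 2 2"
  shows "det A = A $$ (0,0) * A $$ (1,1) - A $$ (1,0) * A $$ (0,1)"
proof -
  have "{..<2::nat} = {0,1}" by auto
  moreover have "det (mat_delete A i 0) = mat_delete A i 0 $$ (0,0)" for i
    using A by (intro det_single) (simp add: mat_delete_def)
  ultimately show ?thesis
    using laplace_expansion_column[OF A, of 0] A by (simp add: cofactor_def mat_delete_def)
qed

lemma det_carrier_3:
  fixes A :: "'a :: comm_ring_1 mat"
  assumes A: "A \<in> carrier_mat 3 3"
  shows "det A = A $$ (0,0) * (A $$ (1,1) * A $$ (2,2) - A $$ (2,1) * A $$ (1,2))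
    - A $$ (1,0) * (A $$ (0,1) * A $$ (2,2) - A $$ (2,1) * A $$ (0,2))
    + A $$ (2,0) * (A $$ (0,1) * A $$ (1,2) - A $$ (1,1) * A $$ (0,2))"
proof -
  have "{..<3::nat} = {0,1,2}" by auto
  moreover have "mat_delete A i 0 \<in> carrier_mat 2 2" for i
    using A by (simp add: mat_delete_def)
  ultimately show ?thesis
    using laplace_expansion_column[OF A, of 0] A
    by (simp add: cofactor_def det_carrier_2) (simp add: mat_delete_def numeral_2_eq_2 algebra_simps)
qed

text \<open>Columns 0 and 2 are supported in the top two rows, columns 1 and 3 in the bottom two.
  Swapping columns 1 and 2 makes the matrix block diagonal, which explains the sign and the product
  of two minors.\<close>

lemma det_interleaved_blocks:
  fixes v :: "nat \<Rightarrow> nat \<Rightarrow> 'a :: comm_ring_1"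
  shows "det (mat 4 4 (\<lambda>(r, c). if c mod 2 = r div 2 then v c (r mod 2) else 0)) =
    - ((v 0 0 * v 2 1 - v 0 1 * v 2 0) * (v 1 0 * v 3 1 - v 1 1 * v 3 0))"
proof -
  define N where "N = mat 4 4 (\<lambda>(r, c). if c mod 2 = r div 2 then v c (r mod 2) else 0)"
  have N: "N \<in> carrier_mat 4 4" by (simp add: N_def)
  have "{..<4::nat} = {0,1,2,3}" by auto
  moreover have "mat_delete N i 0 \<in> carrier_mat 3 3" for i
    using N by (simp add: mat_delete_def)
  moreover have "Suc 2 = 3" by simp
  ultimately show ?thesis
    unfolding N_def[symmetric]
    using laplace_expansion_column[OF N, of 0]
    by (simp add: cofactor_def det_carrier_3) (simp add: mat_delete_def N_def, simp add: numeral_2_eq_2 algebra_simps)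
qed
text \<open>The upper and lower halves of the scalar part are both the identity. Subtracting the
  upper four rows from the lower four leaves \<open>V - U\<close>, where \<open>U\<close> carries
  the forms of \<open>Q 0\<close> and \<open>Q 1\<close> and \<open>V\<close> those of
  \<open>Q 2\<close> and \<open>Q 3\<close>; hence the minus sign on the columns
  \<open>c < 2\<close>.\<close>

lemma det_critical_mat_coordinate_projections:
  fixes Q :: "nat \<Rightarrow> complex mat"
  defines "P \<equiv> \<lambda>i. mat 2 4 (\<lambda>(s, c). if c = 2 * (i mod 2) + s then 1 else 0)"
  defines "q \<equiv> \<lambda>i s. lin_form (row (Q i) s)"
  shows "det (critical_mat P Q) =
    det (mat 4 4 (\<lambda>(r, c). if c mod 2 = r div 2
      then (if c < 2 then - q c (r mod 2) else q c (r mod 2)) else 0))"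
    (is "_ = det ?N")
proof -
  define U where "U = mat 4 4 (\<lambda>(r, c). if c = r div 2 then q c (r mod 2) else 0)"
  define V where "V = mat 4 4 (\<lambda>(r, c). if c = 2 + r div 2 then q c (r mod 2) else 0)"
  have c: "Const 0 = 0" "Const 1 = 1" by (simp_all add: Const_def single_one)
  have "critical_mat P Q = four_block_mat (1\<^sub>m 4) U (1\<^sub>m 4) V"
  proof (rule eq_matI)
    fix r c assume "r < dim_row (four_block_mat (1\<^sub>m 4) U (1\<^sub>m 4) V)"
      "c < dim_col (four_block_mat (1\<^sub>m 4) U (1\<^sub>m 4) V)"
    then have "r \<in> {0,1,2,3,4,5,6,7}" "c < 8" by (auto simp: U_def V_def)
    then show "critical_mat P Q $$ (r, c) = four_block_mat (1\<^sub>m 4) U (1\<^sub>m 4) V $$ (r, c)"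
      unfolding insert_iff empty_iff
      by (elim disjE) 
        (auto simp: critical_mat_def P_def U_def V_def q_def c,
          simp_all add: numeral_2_eq_2 numeral_3_eq_3)
  qed (simp_all add: critical_mat_def U_def V_def)
  then have "det (critical_mat P Q) = det (V - U)"
    using det_four_block_mat[of "1\<^sub>m 4" 4 U "1\<^sub>m 4" V] by (simp add: U_def V_def)
  also have "V - U = ?N"
  proof (rule eq_matI)
    fix r c assume "r < dim_row (?N)"
      "c < dim_col (?N)"
    then have "r < 4" "c \<in> {0,1,2,3}" by auto
    then show "(V - U) $$ (r, c) = ?N $$ (r, c)"
      unfolding insert_iff empty_iff
      by (elim disjE) (auto simp: U_def V_def)
  qed (simp_all add: U_def V_def)
  finally show ?thesis .
qed

section \<open>The coordinate projections\<close>

lemma projection_4tuple_coordinate_projections: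
  "projection_4tuple (\<lambda>i. mat 2 4 (\<lambda>(s, c). if c = 2 * (i mod 2) + s then 1 else 0))"
proof -
  let ?P = "\<lambda>i. mat 2 4 (\<lambda>(s, c). if c = 2 * (i mod 2) + s then 1 else 0) :: complex mat"
  have P: "?P i *\<^sub>v x = vec 2 (\<lambda>s. x $ (2 * (i mod 2) + s))" if x: "x \<in> carrier_vec 4" for i x
  proof (rule eq_vecI)
    fix s assume "s < dim_vec (vec 2 (\<lambda>s. x $ (2 * (i mod 2) + s)))"
    then have "s < 2" "2 * (i mod 2) + s < 4" by auto
    then show "(?P i *\<^sub>v x) $ s = vec 2 (\<lambda>s. x $ (2 * (i mod 2) + s)) $ s"
      using x by (simp add: scalar_prod_def if_distrib[of "\<lambda>a. a * _"] cong: if_cong)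
  qed simp
  have "projection_mat (?P i)" for i
    unfolding projection_mat_def
  proof
    show "vec_space.rank 2 (?P i) = 2"
    proof (rule rank_surjective)
      fix y :: "complex vec" assume y: "y \<in> carrier_vec 2"
      \<comment> \<open>The preimage repeats \<open>y\<close> in both pairs of coordinates, so it
        serves both parities of \<open>i\<close>.\<close>
      have "?P i *\<^sub>v vec 4 (\<lambda>c. y $ (c mod 2)) = y"
        using y unfolding P[OF vec_carrier] by (intro eq_vecI) auto
      then show "\<exists>x\<in>carrier_vec 4. ?P i *\<^sub>v x = y" by (rule bexI) simp
    qed simp
  qed simp
  moreover have "(\<Inter>i<4. center (?P i)) = {0\<^sub>v 4}"
  proof -
    have "x = 0\<^sub>v 4" if x: "\<forall>i<4. x \<in> center (?P i)" for x
    proof -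
      \<comment> \<open>These two projections together read off all four coordinates.\<close>
      have "x \<in> center (?P 0)" "x \<in> center (?P 1)"
        using x[rule_format, of 0] x[rule_format, of 1] by simp_all
      then have xc: "x \<in> carrier_vec 4" and k: "?P 0 *\<^sub>v x = 0\<^sub>v 2" "?P 1 *\<^sub>v x = 0\<^sub>v 2"
        unfolding center_def mat_kernel_def by simp_all
      have z: "x $ s = 0" "x $ (2 + s) = 0" if "s < 2" for s
        using arg_cong[OF k(1), of "\<lambda>w. w $ s"] arg_cong[OF k(2), of "\<lambda>w. w $ s"] that
        unfolding P[OF xc] by simp_all
      show ?thesis
      proof (rule eq_vecI)
        fix j assume "j < dim_vec (0\<^sub>v 4 :: complex vec)"
        then have "j \<in> {0,1,2,3}" by auto
        then show "x $ j = 0\<^sub>v 4 $ j" using z[of 0] z[of 1] by auto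
      qed (use xc in simp)
    qed
    moreover have "0\<^sub>v 4 \<in> center (?P i)" for i
      unfolding center_def by (rule mat_kernelI) auto
    ultimately show ?thesis by blast
  qed
  ultimately show ?thesis unfolding projection_4tuple_def by blast
qed

section \<open>Skew lines as centers of projections\<close>

text \<open>Placing the bases \<open>U\<close> and \<open>U'\<close> side by side gives a square
  invertible matrix \<open>T\<close>. Its inverse yields coordinates along \<open>L\<close> and
  along \<open>L'\<close>; the block of coordinates along one subspace vanishes exactly on the
  other.\<close>

lemma complementary_images_as_kernels:
  fixes L L' :: "'a :: field vec set"
  assumes U: "U \<in> carrier_mat (n + m) n" "L = (\<lambda>y. U *\<^sub>v y) ` carrier_vec n" "mat_kernel U = {0\<^sub>v n}"
    and U': "U' \<in> carrier_mat (n + m) m" "L' = (\<lambda>y. U' *\<^sub>v y) ` carrier_vec m" "mat_kernel U' = {0\<^sub>v m}"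
    and int: "L \<inter> L' = {0\<^sub>v (n + m)}"
  shows "\<exists>A \<in> carrier_mat m (n + m). \<exists>A' \<in> carrier_mat n (n + m).
    mat_kernel A = L \<and> mat_kernel A' = L' \<and>
    (\<forall>a \<in> carrier_vec m. \<forall>a' \<in> carrier_vec n. \<exists>x \<in> carrier_vec (n + m). A *\<^sub>v x = a \<and> A' *\<^sub>v x = a')"
proof -
  let ?k = "n + m"
  define T where "T = mat ?k ?k (\<lambda>(i, j). if j < n then U $$ (i, j) else U' $$ (i, j - n))"
  have T: "T \<in> carrier_mat ?k ?k" by (simp add: T_def)
  have Tapp: "T *\<^sub>v (y @\<^sub>v y') = U *\<^sub>v y + U' *\<^sub>v y'"
    if "y \<in> carrier_vec n" "y' \<in> carrier_vec m" for y y'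
  proof (rule eq_vecI)
    fix i assume "i < dim_vec (U *\<^sub>v y + U' *\<^sub>v y')"
    then have i: "i < ?k" using U' by auto
    have "row T i = row U i @\<^sub>v row U' i"
      using i U(1) U'(1) by (intro eq_vecI) (auto simp: T_def)
    then show "(T *\<^sub>v (y @\<^sub>v y')) $ i = (U *\<^sub>v y + U' *\<^sub>v y') $ i"
      using i T U(1) U'(1) that scalar_prod_append[of "row U i" n "row U' i" m y y'] by simp
  qed (use T U' in auto)
  have split: "x = vec_first x n @\<^sub>v vec_last x m" "vec_first x n \<in> carrier_vec n" "vec_last x m \<in> carrier_vec m"
    if "x \<in> carrier_vec ?k" for x :: "'a vec"
    using that by auto
  \<comment> \<open>A kernel vector of \<open>T\<close> splits into \<open>y\<close> and
    \<open>y'\<close>, and \<open>U\<close> at \<open>y\<close> equals \<open>U'\<close> at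
    \<open>- y'\<close>. This vector lies in \<open>L\<close> and in \<open>L'\<close>, so it is
    zero, and injectivity of \<open>U\<close> and \<open>U'\<close> kills both parts.\<close>
  have "det T \<noteq> 0"
  proof
    assume "det T = 0"
    then obtain w where w: "w \<in> carrier_vec ?k" "w \<noteq> 0\<^sub>v ?k" "T *\<^sub>v w = 0\<^sub>v ?k"
      using det_0_iff_vec_prod_zero[OF T] by blast
    define y y' where "y = vec_first w n" "y' = vec_last w m"
    have y: "w = y @\<^sub>v y'" "y \<in> carrier_vec n" "y' \<in> carrier_vec m"
      using split[OF w(1)] unfolding y_y'_def by auto
    have c: "U *\<^sub>v y \<in> carrier_vec ?k" "U' *\<^sub>v y' \<in> carrier_vec ?k"
      using U(1) U'(1) y by (auto intro: mult_mat_vec_carrier)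
    have sum0: "U *\<^sub>v y + U' *\<^sub>v y' = 0\<^sub>v ?k" using w(3) Tapp y by simp
    have "U *\<^sub>v y = U' *\<^sub>v (- y')"
    proof (rule eq_vecI)
      fix i assume "i < dim_vec (U' *\<^sub>v (- y'))"
      then show "(U *\<^sub>v y) $ i = (U' *\<^sub>v (- y')) $ i"
        using arg_cong[OF sum0, of "\<lambda>v. v $ i"] U(1) U'(1) y by (simp add: add_eq_0_iff2)
    qed (use U(1) U'(1) in auto)
    moreover have "U *\<^sub>v y \<in> L" "U' *\<^sub>v (- y') \<in> L'"
      unfolding U(2) U'(2) using y by (auto intro!: imageI)
    ultimately have "U *\<^sub>v y \<in> L \<inter> L'" by simp
    then have "U *\<^sub>v y = 0\<^sub>v ?k" using int by auto
    moreover from this have "U' *\<^sub>v y' = 0\<^sub>v ?k" using sum0 c by simp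
    ultimately have "y \<in> mat_kernel U" "y' \<in> mat_kernel U'"
      using y mat_kernelI[OF U(1)] mat_kernelI[OF U'(1)] by auto
    then have "w = 0\<^sub>v ?k" using y(1) U(3) U'(3) by auto
    then show False using w(2) by simp
  qed
  then obtain S where S: "S \<in> carrier_mat ?k ?k" "S * T = 1\<^sub>m ?k" "T * S = 1\<^sub>m ?k"
    using det_non_zero_imp_unit[OF T, of "()"] unfolding Units_def ring_mat_def by auto
  have ST: "S *\<^sub>v (T *\<^sub>v z) = z" if "z \<in> carrier_vec ?k" for z
    using that S T by (metis assoc_mult_mat_vec one_mult_mat_vec)
  have TS: "T *\<^sub>v (S *\<^sub>v z) = z" if "z \<in> carrier_vec ?k" for z
    using that S T by (metis assoc_mult_mat_vec one_mult_mat_vec)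
  \<comment> \<open>The last \<open>m\<close> rows of the inverse give the coordinates along
    \<open>L'\<close>, so \<open>A\<close> has kernel \<open>L\<close>; the first \<open>n\<close>
    rows form \<open>A'\<close>, with kernel \<open>L'\<close>.\<close>
  define A where "A = mat m ?k (\<lambda>(i, j). S $$ (n + i, j))"
  define A' where "A' = mat n ?k (\<lambda>(i, j). S $$ (i, j))"
  have A: "A \<in> carrier_mat m ?k" "A' \<in> carrier_mat n ?k" by (simp_all add: A_def A'_def)
  have Sx: "S *\<^sub>v x = (A' *\<^sub>v x) @\<^sub>v (A *\<^sub>v x)" if x: "x \<in> carrier_vec ?k" for x
  proof (rule eq_vecI)
    fix i assume "i < dim_vec ((A' *\<^sub>v x) @\<^sub>v (A *\<^sub>v x))"
    then have i: "i < ?k" using A by auto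
    have "row S i = (if i < n then row A' i else row A (i - n))"
      using i S(1) by (intro eq_vecI) (auto simp: A_def A'_def)
    then show "(S *\<^sub>v x) $ i = ((A' *\<^sub>v x) @\<^sub>v (A *\<^sub>v x)) $ i"
      using i S(1) A by auto
  qed (use S A in auto)
  \<comment> \<open>The common preimage of \<open>a\<close> and \<open>a'\<close> is the vector with
    coordinates \<open>a'\<close> along \<open>L\<close> and \<open>a\<close> along
    \<open>L'\<close>.\<close>
  have surj: "A *\<^sub>v (U *\<^sub>v a' + U' *\<^sub>v a) = a" "A' *\<^sub>v (U *\<^sub>v a' + U' *\<^sub>v a) = a'"
    if "a \<in> carrier_vec m" "a' \<in> carrier_vec n" for a a'
  proof -
    have c: "U *\<^sub>v a' + U' *\<^sub>v a \<in> carrier_vec ?k"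
      using U(1) U'(1) that by (intro add_carrier_vec mult_mat_vec_carrier)
    have "S *\<^sub>v (U *\<^sub>v a' + U' *\<^sub>v a) = a' @\<^sub>v a" using ST Tapp that by (metis append_carrier_vec)
    then have "(A' *\<^sub>v (U *\<^sub>v a' + U' *\<^sub>v a)) @\<^sub>v (A *\<^sub>v (U *\<^sub>v a' + U' *\<^sub>v a)) = a' @\<^sub>v a"
      using Sx[OF c] by simp
    then show "A *\<^sub>v (U *\<^sub>v a' + U' *\<^sub>v a) = a" "A' *\<^sub>v (U *\<^sub>v a' + U' *\<^sub>v a) = a'"
      using append_vec_eq[OF mult_mat_vec_carrier[OF A(2) c] that(2)] by blast+
  qed
  have U0: "U *\<^sub>v 0\<^sub>v n = 0\<^sub>v ?k" "U' *\<^sub>v 0\<^sub>v m = 0\<^sub>v ?k" using U(1) U'(1) by auto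
  have dec: "x = U *\<^sub>v (A' *\<^sub>v x) + U' *\<^sub>v (A *\<^sub>v x)" if "x \<in> carrier_vec ?k" for x
    using TS[OF that] Sx[OF that] Tapp[of "A' *\<^sub>v x" "A *\<^sub>v x"] A that by simp
  have "mat_kernel A = L"
  proof
    show "mat_kernel A \<subseteq> L"
    proof
      fix x assume "x \<in> mat_kernel A"
      then have x: "x \<in> carrier_vec ?k" "A *\<^sub>v x = 0\<^sub>v m" using mat_kernelD[OF A(1)] by auto
      then have "x = U *\<^sub>v (A' *\<^sub>v x)" using dec[OF x(1)] U0 U(1) A by auto
      then show "x \<in> L" using U(2) A x by (metis imageI mult_mat_vec_carrier)
    qed
    show "L \<subseteq> mat_kernel A"
    proof
      fix x assume "x \<in> L"
      then obtain y where y: "y \<in> carrier_vec n" "x = U *\<^sub>v y" using U(2) by auto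
      then have "A *\<^sub>v x = 0\<^sub>v m" using surj(1)[of "0\<^sub>v m" y] U0 U(1) by auto
      then show "x \<in> mat_kernel A" using y U(1) by (intro mat_kernelI[OF A(1)]) auto
    qed
  qed
  moreover have "mat_kernel A' = L'"
  proof
    show "mat_kernel A' \<subseteq> L'"
    proof
      fix x assume "x \<in> mat_kernel A'"
      then have x: "x \<in> carrier_vec ?k" "A' *\<^sub>v x = 0\<^sub>v n" using mat_kernelD[OF A(2)] by auto
      then have "x = U' *\<^sub>v (A *\<^sub>v x)" using dec[OF x(1)] U0 U'(1) A by auto
      then show "x \<in> L'" using U'(2) A x by (metis imageI mult_mat_vec_carrier)
    qed
    show "L' \<subseteq> mat_kernel A'"
    proof
      fix x assume "x \<in> L'"
      then obtain y where y: "y \<in> carrier_vec m" "x = U' *\<^sub>v y" using U'(2) by auto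
      then have "A' *\<^sub>v x = 0\<^sub>v n" using surj(2)[of y "0\<^sub>v n"] U0 U'(1) by auto
      then show "x \<in> mat_kernel A'" using y U'(1) by (intro mat_kernelI[OF A(2)]) auto
    qed
  qed
  moreover have "\<exists>x \<in> carrier_vec ?k. A *\<^sub>v x = a \<and> A' *\<^sub>v x = a'"
    if "a \<in> carrier_vec m" "a' \<in> carrier_vec n" for a a'
    using surj[OF that] U(1) U'(1) that
    by (intro bexI[of _ "U *\<^sub>v a' + U' *\<^sub>v a"] conjI add_carrier_vec mult_mat_vec_carrier)
  ultimately show ?thesis using A by blast
qed

text \<open>The case \<open>n = m = 2\<close>. The point \<open>x\<close> is a certificate: there
  the 2 by 2 determinant with columns \<open>A\<close> and \<open>A'\<close> applied to
  \<open>x\<close> equals 1, so the corresponding quadratic form is nonzero.\<close>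

lemma skew_lines_as_centers:
  assumes "proj_line L" "proj_line L'" "skew L L'"
  shows "\<exists>A A' x. projection_mat A \<and> projection_mat A' \<and> center A = L \<and> center A' = L' \<and>
    x \<in> carrier_vec 4 \<and> A *\<^sub>v x = unit_vec 2 0 \<and> A' *\<^sub>v x = unit_vec 2 1"
proof -
  obtain U where U: "U \<in> carrier_mat 4 2" "L = (\<lambda>y. U *\<^sub>v y) ` carrier_vec 2" "mat_kernel U = {0\<^sub>v 2}"
    using subspace_parametrization[of L 4 2] assms(1) unfolding proj_line_def by blast
  obtain U' where U': "U' \<in> carrier_mat 4 2" "L' = (\<lambda>y. U' *\<^sub>v y) ` carrier_vec 2" "mat_kernel U' = {0\<^sub>v 2}"
    using subspace_parametrization[of L' 4 2] assms(2) unfolding proj_line_def by blast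
  obtain A A' where A: "A \<in> carrier_mat 2 4" "A' \<in> carrier_mat 2 4" "mat_kernel A = L" "mat_kernel A' = L'"
    and surj: "\<And>a a'. a \<in> carrier_vec 2 \<Longrightarrow> a' \<in> carrier_vec 2 \<Longrightarrow>
      \<exists>x\<in>carrier_vec 4. A *\<^sub>v x = a \<and> A' *\<^sub>v x = a'"
    using complementary_images_as_kernels[of U 2 2 L U' L'] U U' assms(3) by (auto simp: skew_def)
  have "projection_mat A" "projection_mat A'"
    unfolding projection_mat_def using A(1,2) surj rank_surjective[OF A(1)] rank_surjective[OF A(2)]
    by (metis zero_carrier_vec)+
  then show ?thesis
    unfolding center_def using A(3,4) surj[of "unit_vec 2 0" "unit_vec 2 1"] by auto
qed

section \<open>Construction of the quartic\<close>

theorem proposition7p3: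
  fixes l :: "nat \<Rightarrow> complex vec set"
  assumes "\<forall>i<4. proj_line (l i)"
    and "\<forall>i<4. \<forall>j<4. i \<noteq> j \<longrightarrow> skew (l i) (l j)"
  shows "\<exists>S. quartic_determinantal_surface S \<and>
           (\<forall>i<4. contains_line S (l i)) \<and>
           (\<exists>P Q. projection_4tuple P \<and> projection_4tuple Q \<and>
                  S = critical_locus P Q \<and>
                  (\<forall>i<4. center (Q i) = l i))"
proof -
  \<comment> \<open>Lines of equal parity are paired because \<open>P i\<close> depends only on
    \<open>i mod 2\<close>, so their forms meet in the same rows after elimination.\<close>
  obtain Q0 Q2 x where Q02: "projection_mat Q0" "projection_mat Q2" "center Q0 = l 0" "center Q2 = l 2"
    "x \<in> carrier_vec 4" "Q0 *\<^sub>v x = unit_vec 2 0" "Q2 *\<^sub>v x = unit_vec 2 1"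
    using skew_lines_as_centers[of "l 0" "l 2"] assms by auto
  obtain Q1 Q3 z where Q13: "projection_mat Q1" "projection_mat Q3" "center Q1 = l 1" "center Q3 = l 3"
    "z \<in> carrier_vec 4" "Q1 *\<^sub>v z = unit_vec 2 0" "Q3 *\<^sub>v z = unit_vec 2 1"
    using skew_lines_as_centers[of "l 1" "l 3"] assms by auto
  define Q where "Q i = [Q0, Q1, Q2, Q3] ! i" for i
  define P :: "nat \<Rightarrow> complex mat"
    where "P = (\<lambda>i. mat 2 4 (\<lambda>(s, c). if c = 2 * (i mod 2) + s then 1 else 0))"
  define q where "q i s = lin_form (row (Q i) s)" for i s
  \<comment> \<open>The zeros of this quadratic form are the points whose images under
    \<open>Q i\<close> and \<open>Q j\<close> are linearly dependent; it vanishes on the centers of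
    both.\<close>
  define w where "w i j = q i 0 * q j 1 - q i 1 * q j 0" for i j
  define N where "N = mat 4 4 (\<lambda>(r, c). if c mod 2 = r div 2
    then (if c < 2 then - q c (r mod 2) else q c (r mod 2)) else 0)"
  have lt4: "i < 4 \<longleftrightarrow> i = 0 \<or> i = 1 \<or> i = 2 \<or> i = 3" for i :: nat by auto
  have Q: "projection_mat (Q i)" "center (Q i) = l i" if "i < 4" for i
    using that Q02 Q13 unfolding Q_def lt4 by auto
  have Qc: "Q i \<in> carrier_mat 2 4" if "i < 4" for i using Q(1)[OF that] by (simp add: projection_mat_def)
  have eval_q: "eval_poly4 (q i s) y = (Q i *\<^sub>v y) $ s" if "i < 4" "s < 2" "y \<in> carrier_vec 4" for i s y
    unfolding q_def using eval_poly4_lin_form[OF that(3)] Qc[OF that(1)] that(2) by simp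
  have det_N: "det N = - (w 0 2 * w 1 3)"
    unfolding N_def
    using det_interleaved_blocks[of "\<lambda>c s. if c < 2 then - q c s else q c s"]
    by (simp add: w_def algebra_simps)
  have w_nz: "w i j \<noteq> 0" if "i < 4" "j < 4" "y \<in> carrier_vec 4"
      "Q i *\<^sub>v y = unit_vec 2 0" "Q j *\<^sub>v y = unit_vec 2 1" for i j y
  proof
    assume "w i j = 0"
    moreover have "eval_poly4 (w i j) y = 1"
      unfolding w_def using that by (simp add: hom_distribs eval_q)
    ultimately show False by simp
  qed
  have "w 0 2 \<noteq> 0" "w 1 3 \<noteq> 0"
    using w_nz[of 0 2 x] w_nz[of 1 3 z] Q02 Q13 by (simp_all add: Q_def)
  \<comment> \<open>The two certificate points may differ: the polynomial ring has no zero divisors,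
    so nonzero factors suffice.\<close>
  then have nz: "det N \<noteq> 0" unfolding det_N by simp
  have crit: "critical_locus P Q = hypersurface (det N)"
    unfolding critical_locus_def P_def N_def q_def using det_critical_mat_coordinate_projections[of Q] by simp
  have "quartic_determinantal_surface (hypersurface (det N))"
    unfolding quartic_determinantal_surface_def
  proof (intro bexI[of _ N] conjI allI impI)
    fix r c :: nat assume rc: "r < 4" "c < 4"
    have row: "row (Q c) s \<in> carrier_vec 4" for s using Qc[OF rc(2)] by (metis carrier_matD(2) row_carrier)
    have "lin_form (0\<^sub>v 4) = 0" "lin_form (- row (Q c) (r mod 2)) = - q c (r mod 2)"
      using row by (simp_all add: q_def lin_form_uminus)
    then have "\<exists>a\<in>carrier_vec 4. lin_form a = N $$ (r, c)"
      using rc row by (auto simp: N_def q_def intro: bexI[of _ "0\<^sub>v 4"] bexI[of _ "- row (Q c) (r mod 2)"])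
    then show "N $$ (r, c) \<in> lin_form ` carrier_vec 4" by force
  qed (use nz in \<open>simp_all add: N_def\<close>)
  moreover have "contains_line (hypersurface (det N)) (l i)" if i: "i < 4" for i
  proof -
    have "eval_poly4 (det N) y = 0" if "y \<in> l i" for y
    proof -
      have "y \<in> mat_kernel (Q i)" using that Q(2)[OF i] by (simp add: center_def)
      then have y: "y \<in> carrier_vec 4" "Q i *\<^sub>v y = 0\<^sub>v 2" using mat_kernelD[OF Qc[OF i]] by auto
      \<comment> \<open>Each index occurs in exactly one of the factors \<open>w 0 2\<close> and
        \<open>w 1 3\<close>, and every term of that factor contains one of these two forms.\<close>
      have "eval_poly4 (q i 0) y = 0" "eval_poly4 (q i 1) y = 0" using eval_q[OF i _ y(1)] y(2) by simp_all
      then show ?thesis using i unfolding lt4 det_N w_def by (auto simp: hom_distribs)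
    qed
    then show ?thesis
      unfolding contains_line_def hypersurface_def vanishing_ideal_def by (auto simp: eval_poly4_mult)
  qed
  moreover have "projection_4tuple P" unfolding P_def by (rule projection_4tuple_coordinate_projections)
  moreover have "projection_4tuple Q"
  proof -
    \<comment> \<open>Two skew centers already meet only in the zero vector.\<close>
    have "(\<Inter>i<4. center (Q i)) \<subseteq> l 0 \<inter> l 1" using Q(2)[of 0] Q(2)[of 1] by auto
    also have "\<dots> = {0\<^sub>v 4}" using assms(2) by (simp add: skew_def)
    finally have "(\<Inter>i<4. center (Q i)) \<subseteq> {0\<^sub>v 4}" .
    moreover have "0\<^sub>v 4 \<in> center (Q i)" if "i < 4" for i
      unfolding center_def using Qc[OF that] by (intro mat_kernelI) auto
    ultimately show ?thesis unfolding projection_4tuple_def using Q(1) by blast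
  qed
  ultimately show ?thesis using crit Q(2) by metis
qed

end
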